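(* Basic convergence is not metrizable on $\mathcal{W}$; that is, there is no metric $d$ on $\mathcal{W}$ such that for all $f_n,f\in\mathcal{W}$ ($n\in\mathbb{N}$), $d(f_n,f)\to0$ as $n\to\infty$ if and only if $f_n$ converges basically to $f$.
   Context: $\mathcal{W}$ is the set of right-continuous functions $f:\mathbb{R}\to\mathbb{R}$ of bounded variation (i.e. $\lim_{n\to\infty}TV_{[-n,n]}f<\infty$, where $TV_{[a,b]}f$ is the total variation of $f$ on $[a,b]$) with $\lim_{x\to-\infty}f(x)=0$. Functions $f_n:\mathbb{R}\to\mathbb{R}$ converge basically to $f:\mathbb{R}\to\mathbb{R}$ if every subsequence $(f_{n_k})_{k}$ contains a further subsequence $(f_{n_{k_l}})_{l}$ and there is an at most countable set $S\subset\mathbb{R}$ (which may depend on the subsequence) such that $f_{n_{k_l}}(x_1)-f_{n_{k_l}}(x_2)\to f(x_1)-f(x_2)$ as $l\to\infty$ for all $x_1,x_2\in\mathbb{R}\setminus S$. *)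

theory Defs
  imports "HOL-Analysis.Analysis"
begin

definition total_variation :: "real \<Rightarrow> real \<Rightarrow> (real \<Rightarrow> real) \<Rightarrow> ennreal" where
  "total_variation a b f =
     (SUP (k, t) \<in> {(k :: nat, t :: nat \<Rightarrow> real).
        t 0 = a \<and> t k = b \<and> (\<forall>i<k. t i < t (Suc i))}.
      ennreal (\<Sum>i<k. \<bar>f (t (Suc i)) - f (t i)\<bar>))"

text \<open>The limit below always exists in \<^typ>\<open>ennreal\<close>, since the total variation on
  \<open>[-n, n]\<close> is nondecreasing in \<open>n\<close>.\<close>

definition bounded_variation :: "(real \<Rightarrow> real) \<Rightarrow> bool" where
  "bounded_variation f \<longleftrightarrow>
     lim (\<lambda>n. total_variation (- real n) (real n) f) < \<infinity>"

definition \<W> :: "(real \<Rightarrow> real) set" where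
  "\<W> = {f. (\<forall>x. continuous (at_right x) f) \<and> bounded_variation f \<and> (f \<longlongrightarrow> 0) at_bot}"

definition converges_basically :: "(nat \<Rightarrow> real \<Rightarrow> real) \<Rightarrow> (real \<Rightarrow> real) \<Rightarrow> bool" where
  "converges_basically F f \<longleftrightarrow>
     (\<forall>r :: nat \<Rightarrow> nat. strict_mono r \<longrightarrow>
       (\<exists>s :: nat \<Rightarrow> nat. strict_mono s \<and>
         (\<exists>S :: real set. countable S \<and>
           (\<forall>x1 \<in> - S. \<forall>x2 \<in> - S.
             (\<lambda>l. F (r (s l)) x1 - F (r (s l)) x2) \<longlonglongrightarrow> f x1 - f x2))))"

end

theory Submission
  imports Defs
begin

text \<open>In a metric space, if for each \<open>m\<close> a sequence \<open>f\<^sub>m\<^sub>,\<^sub>n\<close> converges to \<open>0\<close> as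
  \<open>n \<rightarrow> \<infinity>\<close>, then some diagonal sequence \<open>f\<^sub>m\<^sub>,\<^sub>N\<^sub>(\<^sub>m\<^sub>)\<close> converges to \<open>0\<close>. Basic convergence violates
  this: let \<open>f\<^sub>m\<^sub>,\<^sub>n\<close> be the sum of the indicators of \<open>[p\<^sub>j, p\<^sub>j + 1/(n+1))\<close>, \<open>j < m\<close>, where
  \<open>p\<close> enumerates the positive rationals. Each row converges to \<open>0\<close> off finitely many points, but
  along any subsequence of any diagonal sequence, the points where the values are infinitely
  often at least \<open>1\<close> contain a dense \<open>G\<^sub>\<delta>\<close> subset of the positive half-line, which by Baire's
  theorem is not contained in any countable set.\<close>

section \<open>Bounded variation of differences of monotone functions\<close>

text \<open>A partition of the inner interval extends to one of the outer by prepending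
  \<open>a'\<close> and appending \<open>b'\<close>; strict inequalities keep the new partition
  strictly increasing, and the two extra terms only add to the sum.\<close>

lemma total_variation_mono:
  assumes "a' < a" "b < b'"
  shows "total_variation a b f \<le> total_variation a' b' f"
  unfolding total_variation_def
proof (rule SUP_least, clarify)
  fix k :: nat and t :: "nat \<Rightarrow> real"
  assume t: "a = t 0" "b = t k" "\<forall>i<k. t i < t (Suc i)"
  define u where "u i = (case i of 0 \<Rightarrow> a' | Suc i \<Rightarrow> if i \<le> k then t i else b')" for i
  have u_Suc: "u (Suc i) = t i" if "i \<le> k" for i
    using that by (simp add: u_def)
  have ends: "u 0 = a'" "u (Suc (Suc k)) = b'"
    by (simp_all add: u_def)
  have less: "u i < u (Suc i)" if "i < Suc (Suc k)" for i
    using that t assms by (cases i) (auto simp: u_def less_Suc_eq)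
  have "(\<Sum>i<k. \<bar>f (t (Suc i)) - f (t i)\<bar>) = (\<Sum>i<k. \<bar>f (u (Suc (Suc i))) - f (u (Suc i))\<bar>)"
    by (intro sum.cong) (auto simp: u_Suc)
  also have "\<dots> \<le> (\<Sum>i<Suc k. \<bar>f (u (Suc i)) - f (u i)\<bar>)"
    by (subst sum.lessThan_Suc_shift) simp
  also have "\<dots> \<le> (\<Sum>i<Suc (Suc k). \<bar>f (u (Suc i)) - f (u i)\<bar>)"
    by simp
  finally have "ennreal (\<Sum>i<k. \<bar>f (t (Suc i)) - f (t i)\<bar>)
      \<le> ennreal (\<Sum>i<Suc (Suc k). \<bar>f (u (Suc i)) - f (u i)\<bar>)"
    by (rule ennreal_leI)
  then show "ennreal (\<Sum>i<k. \<bar>f (t (Suc i)) - f (t i)\<bar>)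
      \<le> (SUP (k, s) \<in> {(k, s). s 0 = a' \<and> s k = b' \<and> (\<forall>i<k. s i < s (Suc i))}.
            ennreal (\<Sum>i<k. \<bar>f (s (Suc i)) - f (s i)\<bar>))"
    using ends less by (intro SUP_upper2[where i = "(Suc (Suc k), u)"]) auto
qed

text \<open>Each increment of the difference is at most the sum of the increments of
  \<open>g\<close> and \<open>h\<close> in absolute value, and these are nonnegative and
  telescope.\<close>

lemma total_variation_diff_mono_le:
  assumes "mono g" "mono h"
  shows "total_variation a b (\<lambda>x. g x - h x) \<le> ennreal ((g b - g a) + (h b - h a))"
  unfolding total_variation_def
proof (rule SUP_least, clarify)
  fix k :: nat and t :: "nat \<Rightarrow> real"
  assume t: "\<forall>i<k. t i < t (Suc i)"
  have "(\<Sum>i<k. \<bar>(g (t (Suc i)) - h (t (Suc i))) - (g (t i) - h (t i))\<bar>)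
      \<le> (\<Sum>i<k. (g (t (Suc i)) - g (t i)) + (h (t (Suc i)) - h (t i)))"
  proof (rule sum_mono)
    fix i assume "i \<in> {..<k}"
    then have "t i \<le> t (Suc i)"
      using t by (simp add: less_imp_le)
    then have "g (t i) \<le> g (t (Suc i))" "h (t i) \<le> h (t (Suc i))"
      using assms by (auto dest: monoD)
    then show "\<bar>(g (t (Suc i)) - h (t (Suc i))) - (g (t i) - h (t i))\<bar>
        \<le> (g (t (Suc i)) - g (t i)) + (h (t (Suc i)) - h (t i))"
      by linarith
  qed
  also have "\<dots> = (g (t k) - g (t 0)) + (h (t k) - h (t 0))"
    using sum_lessThan_telescope[of "\<lambda>i. g (t i)" k] sum_lessThan_telescope[of "\<lambda>i. h (t i)" k]
    by (simp only: sum.distrib)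
  finally show "ennreal (\<Sum>i<k. \<bar>(g (t (Suc i)) - h (t (Suc i))) - (g (t i) - h (t i))\<bar>)
      \<le> ennreal ((g (t k) - g (t 0)) + (h (t k) - h (t 0)))"
    by (rule ennreal_leI)
qed

lemma bounded_variation_diff_mono:
  fixes g h :: "real \<Rightarrow> real"
  assumes mono: "mono g" "mono h"
    and bounds: "\<And>x. 0 \<le> g x" "\<And>x. g x \<le> C" "\<And>x. 0 \<le> h x" "\<And>x. h x \<le> C"
  shows "bounded_variation (\<lambda>x. g x - h x)"
proof -
  let ?V = "\<lambda>n. total_variation (- real n) (real n) (\<lambda>x. g x - h x)"
  \<comment> \<open>Monotonicity in \<open>n\<close> turns the limit in
    \<open>bounded_variation\<close> into a supremum, which a bound uniform in \<open>n\<close>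
    controls.\<close>
  have "incseq ?V"
    by (intro incseq_SucI total_variation_mono) auto
  then have "lim ?V = (SUP n. ?V n)"
    by (intro limI LIMSEQ_SUP)
  also have "\<dots> \<le> ennreal (2 * C)"
  proof (rule SUP_least)
    fix n
    have "(g (real n) - g (- real n)) + (h (real n) - h (- real n)) \<le> 2 * C"
      using bounds[of "real n"] bounds[of "- real n"] by linarith
    then show "?V n \<le> ennreal (2 * C)"
      by (intro order_trans[OF total_variation_diff_mono_le[OF mono]] ennreal_leI)
  qed
  also have "\<dots> < \<infinity>"
    by simp
  finally show ?thesis
    unfolding bounded_variation_def .
qed

lemma indicator_atLeast_continuous_at_right:
  "continuous (at_right x) (indicator {a..} :: real \<Rightarrow> real)"
proof -
  have "\<forall>\<^sub>F y in at_right x. indicator {a..} y = (indicator {a..} x :: real)"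
  proof (cases "a \<le> x")
    case True
    then show ?thesis
      by (auto simp: eventually_at_right_field intro!: exI[of _ "x + 1"])
  next
    case False
    then show ?thesis
      by (auto simp: eventually_at_right_field intro!: exI[of _ a])
  qed
  then show ?thesis
    unfolding continuous_within by (rule tendsto_eventually)
qed

section \<open>Spike functions and their convergence along rows\<close>

text \<open>Closing the intervals on the left makes the sum right-continuous, as \<W>
  demands.\<close>

definition spikes :: "(nat \<Rightarrow> real) \<Rightarrow> nat \<Rightarrow> nat \<Rightarrow> real \<Rightarrow> real" where
  "spikes p m n x = (\<Sum>j<m. indicator {p j..<p j + 1 / real (Suc n)} x)"

text \<open>Splitting into two monotone step functions gives the form from which bounded variation
  and right-continuity follow.\<close>

lemma spikes_eq_diff:
  "spikes p m n =
     (\<lambda>x. (\<Sum>j<m. indicator {p j..} x) - (\<Sum>j<m. indicator {p j + 1 / real (Suc n)..} x))"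
proof
  fix x
  have "indicator {a..<b} x = (indicator {a..} x - indicator {b..} x :: real)" if "a < b" for a b :: real
    using that by (auto simp: indicator_def)
  then have "indicator {p j..<p j + 1 / real (Suc n)} x
      = (indicator {p j..} x - indicator {p j + 1 / real (Suc n)..} x :: real)" for j
    by (simp del: of_nat_Suc)
  then show "spikes p m n x = (\<Sum>j<m. indicator {p j..} x)
      - (\<Sum>j<m. indicator {p j + 1 / real (Suc n)..} x)"
    by (simp add: spikes_def sum_subtractf)
qed

lemma spikes_eq_0: "spikes p m n x = 0" if "\<And>j. j < m \<Longrightarrow> x < p j"
  using that by (force simp: spikes_def intro!: sum.neutral)

lemma one_le_spikes:
  assumes "j < m" "p j \<le> x" "x < p j + 1 / real (Suc n)"
  shows "1 \<le> spikes p m n x"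
proof -
  have "1 = (indicator {p j..<p j + 1 / real (Suc n)} x :: real)"
    using assms by simp
  also have "\<dots> \<le> spikes p m n x"
    unfolding spikes_def using assms(1) by (intro member_le_sum) auto
  finally show ?thesis .
qed

lemma spikes_in_W: "spikes p m n \<in> \<W>"
proof -
  have mono: "mono (\<lambda>x. \<Sum>j<m. indicator {a j..} x :: real)" for a :: "nat \<Rightarrow> real"
    by (intro monoI sum_mono) (auto simp: indicator_def)
  have le: "(\<Sum>j<m. indicator {a j..} x :: real) \<le> real m" for a :: "nat \<Rightarrow> real" and x
    using sum_bounded_above[of "{..<m}" "\<lambda>j. indicator {a j..} x :: real" 1] by simp
  have "bounded_variation (spikes p m n)"
    unfolding spikes_eq_diff
    by (rule bounded_variation_diff_mono[where C = "real m"]) (auto intro: mono le sum_nonneg)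
  moreover have "continuous (at_right x) (spikes p m n)" for x
    unfolding spikes_eq_diff
    by (intro continuous_diff continuous_sum indicator_atLeast_continuous_at_right)
  moreover have "(spikes p m n \<longlongrightarrow> 0) at_bot"
  proof (rule tendsto_eventually)
    have "\<forall>\<^sub>F x in at_bot. \<forall>j\<in>{..<m}. x < p j"
      by (intro eventually_ball_finite) (auto intro: eventually_gt_at_bot)
    then show "\<forall>\<^sub>F x in at_bot. spikes p m n x = 0"
      by eventually_elim (auto intro: spikes_eq_0)
  qed
  ultimately show ?thesis
    by (simp add: \<W>_def)
qed

text \<open>A point other than \<open>p j\<close> lies to its left or at a positive distance to its
  right that the shrinking width eventually undercuts; only finitely many \<open>j\<close>
  occur.\<close>

lemma spikes_tendsto_0:
  assumes "x \<notin> p ` {..<m}"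
  shows "(\<lambda>n. spikes p m n x) \<longlonglongrightarrow> 0"
  unfolding spikes_def
proof (rule tendsto_null_sum, rule tendsto_eventually)
  fix j assume "j \<in> {..<m}"
  then have "x \<noteq> p j"
    using assms by auto
  then consider "x < p j" | "0 < x - p j"
    by linarith
  then show "\<forall>\<^sub>F n in sequentially. indicator {p j..<p j + 1 / real (Suc n)} x = (0 :: real)"
  proof cases
    case 2
    have "\<forall>\<^sub>F n in sequentially. 1 / real (Suc n) < x - p j"
      using order_tendstoD(2)[OF LIMSEQ_inverse_real_of_nat 2] by (simp add: inverse_eq_divide)
    then show ?thesis
      by eventually_elim (auto simp: indicator_def)
  qed simp
qed

lemma spikes_converges_basically: "converges_basically (spikes p m) (\<lambda>x. 0)"
  unfolding converges_basically_def
proof (intro allI impI)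
  fix r :: "nat \<Rightarrow> nat"
  assume r: "strict_mono r"
  have "(\<lambda>l. spikes p m (r l) x1 - spikes p m (r l) x2) \<longlonglongrightarrow> 0 - 0"
    if "x1 \<in> - p ` {..<m}" "x2 \<in> - p ` {..<m}" for x1 x2
    using LIMSEQ_subseq_LIMSEQ[OF spikes_tendsto_0 r] that
    by (intro tendsto_diff) (auto simp: o_def)
  then show "\<exists>s. strict_mono s \<and> (\<exists>S. countable S \<and> (\<forall>x1\<in>- S. \<forall>x2\<in>- S.
      (\<lambda>l. spikes p m (r (s l)) x1 - spikes p m (r (s l)) x2) \<longlonglongrightarrow> 0 - 0))"
    \<comment> \<open>The row already converges off the finite set of left endpoints, so every
      subsequence serves as its own further subsequence.\<close>
    by (intro exI[of _ "\<lambda>l. l"] conjI exI[of _ "p ` {..<m}"]) (auto simp: strict_mono_def)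
qed

section \<open>Failure of convergence along diagonals\<close>

lemma spikes_diagonal_frequently_ge_1:
  fixes p :: "nat \<Rightarrow> real" and s :: "nat \<Rightarrow> nat"
  assumes p: "range p = \<rat> \<inter> {0<..}" and s: "strict_mono s" and S: "countable S"
  obtains x where "x \<notin> S" "\<And>M. \<exists>l\<ge>M. 1 \<le> spikes p (s l) (N (s l)) x"
proof -
  \<comment> \<open>Open intervals make \<open>U M\<close> open. The negative half-line is added to
    make \<open>U M\<close> dense in the whole line, since \<open>p\<close> takes only positive
    values.\<close>
  define U where "U M = {..<0} \<union> (\<Union>l\<in>{M..}. \<Union>j<s l. {p j<..<p j + 1 / real (Suc (N (s l)))})"
    for M
  have open_U: "open (U M)" for M
    unfolding U_def by (intro open_Un open_UN ballI open_lessThan open_greaterThanLessThan)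
  have dense_U: "closure (U M) = UNIV" for M
  proof -
    have "{..<0} \<subseteq> U M"
      by (auto simp: U_def)
    then have nonpos: "{..0} \<subseteq> closure (U M)"
      using closure_mono[of "{..<0}" "U M"] by simp
    have "p j \<in> closure (U M)" for j
    proof -
      \<comment> \<open>As \<open>s l\<close> is at least \<open>l\<close>, this choice gives both
        \<open>M \<le> l\<close> and \<open>j < s l\<close>, so a spike starting at
        \<open>p j\<close> contributes to \<open>U M\<close>.\<close>
      define l where "l = max M (Suc j)"
      have "j < s l"
        using strict_mono_imp_increasing[OF s, of l] by (simp add: l_def)
      then have sub: "{p j<..<p j + 1 / real (Suc (N (s l)))} \<subseteq> U M"
        unfolding U_def using l_def by (intro le_supI2 SUP_upper2[of l] SUP_upper2[of j]) auto
      have "p j < p j + 1 / real (Suc (N (s l)))"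
        by simp
      then have "p j \<in> closure {p j<..<p j + 1 / real (Suc (N (s l)))}"
        by (subst closure_greaterThanLessThan) (auto simp del: of_nat_Suc)
      with closure_mono[OF sub] show ?thesis
        by blast
    qed
    then have "\<rat> \<inter> {0<..} \<subseteq> closure (U M)"
      unfolding p[symmetric] by (rule image_subsetI)
    moreover have "\<rat> \<subseteq> {..0} \<union> (\<rat> \<inter> {0<..} :: real set)"
      by auto
    ultimately have "\<rat> \<subseteq> closure (U M)"
      using nonpos by (meson Un_least order_trans)
    then have "closure \<rat> \<subseteq> closure (U M)"
      by (intro closure_minimal closed_closure)
    then show ?thesis
      by (simp add: Rats_closure_real top_unique)
  qed
  \<comment> \<open>Complements of single points are open and dense too, so avoiding the countable
    set \<open>S\<close> fits into the same Baire intersection.\<close>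
  define G where "G = \<Inter>(range U \<union> (\<lambda>x. - {x}) ` S)"
  have "UNIV \<subseteq> closure G"
    unfolding G_def
    by (rule Baire) (use S in \<open>auto simp: open_U dense_U closure_complement\<close>)
  \<comment> \<open>Restricting to positive points rules out membership in \<open>U M\<close>
    through the added negative half-line.\<close>
  then have "{0<..} \<inter> closure G = {0<..}"
    by blast
  then have "{0<..} \<inter> G \<noteq> {}"
    by (metis open_Int_closure_eq_empty open_greaterThan greaterThan_non_empty)
  then obtain x where x: "0 < x" "\<And>M. x \<in> U M" "x \<notin> S"
    by (auto simp: G_def)
  have "\<exists>l\<ge>M. 1 \<le> spikes p (s l) (N (s l)) x" for M
  proof -
    from x(1) x(2)[of M] obtain l j where "M \<le> l" "j < s l"
      "p j < x" "x < p j + 1 / real (Suc (N (s l)))"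
      unfolding U_def by auto
    then show ?thesis
      by (intro exI[of _ l] conjI one_le_spikes[of j]) auto
  qed
  with x(3) show ?thesis
    by (rule that)
qed

lemma spikes_diagonal_not_converges_basically:
  fixes p :: "nat \<Rightarrow> real"
  assumes p: "range p = \<rat> \<inter> {0<..}"
  shows "\<not> converges_basically (\<lambda>m. spikes p m (N m)) (\<lambda>x. 0)"
proof
  assume "converges_basically (\<lambda>m. spikes p m (N m)) (\<lambda>x. 0)"
  then obtain s S where s: "strict_mono s" and S: "countable S"
    and lim: "\<And>x1 x2. x1 \<notin> S \<Longrightarrow> x2 \<notin> S \<Longrightarrow>
      (\<lambda>l. spikes p (s l) (N (s l)) x1 - spikes p (s l) (N (s l)) x2) \<longlonglongrightarrow> 0"
    unfolding converges_basically_def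
    by (elim allE[of _ "\<lambda>l. l"]) (auto simp: strict_mono_def)
  obtain x where x: "x \<notin> S" "\<And>M. \<exists>l\<ge>M. 1 \<le> spikes p (s l) (N (s l)) x"
    using spikes_diagonal_frequently_ge_1[OF p s S] by metis
  \<comment> \<open>Basic convergence controls only differences, so a reference point outside
    \<open>S\<close> is chosen to the left of all spikes, where every function vanishes.\<close>
  have "uncountable {-1<..<0 :: real}"
    by (simp add: uncountable_open_interval)
  then have "\<not> {-1<..<0} \<subseteq> S"
    using countable_subset[OF _ S] by (rule contrapos_nn)
  then obtain y where y: "y \<in> {-1<..<0}" "y \<notin> S"
    unfolding subset_iff by blast
  have "p j > 0" for j
    using rangeI[of p j] unfolding p by simp
  then have "y < p j" for j
    using y(1) by (auto intro: less_trans)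
  then have "spikes p (s l) (N (s l)) y = 0" for l
    by (rule spikes_eq_0)
  with lim[OF x(1) y(2)] have "(\<lambda>l. spikes p (s l) (N (s l)) x) \<longlonglongrightarrow> 0"
    by simp
  then have "\<forall>\<^sub>F l in sequentially. spikes p (s l) (N (s l)) x < 1"
    by (rule order_tendstoD) simp
  then show False
    using x(2) by (meson eventually_sequentially not_less)
qed

theorem lemma3p2:
  shows "\<not> (\<exists>d :: (real \<Rightarrow> real) \<Rightarrow> (real \<Rightarrow> real) \<Rightarrow> real.
            Metric_space \<W> d \<and>
            (\<forall>F f. (\<forall>n :: nat. F n \<in> \<W>) \<longrightarrow> f \<in> \<W> \<longrightarrow>
               ((\<lambda>n. d (F n) f) \<longlonglongrightarrow> 0 \<longleftrightarrow> converges_basically F f)))"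
proof
  assume "\<exists>d :: (real \<Rightarrow> real) \<Rightarrow> (real \<Rightarrow> real) \<Rightarrow> real.
            Metric_space \<W> d \<and>
            (\<forall>F f. (\<forall>n :: nat. F n \<in> \<W>) \<longrightarrow> f \<in> \<W> \<longrightarrow>
               ((\<lambda>n. d (F n) f) \<longlonglongrightarrow> 0 \<longleftrightarrow> converges_basically F f))"
  then obtain d :: "(real \<Rightarrow> real) \<Rightarrow> (real \<Rightarrow> real) \<Rightarrow> real" where "Metric_space \<W> d"
    and iff: "\<And>F f. \<lbrakk>\<And>n :: nat. F n \<in> \<W>; f \<in> \<W>\<rbrakk> \<Longrightarrow>
      (\<lambda>n. d (F n) f) \<longlonglongrightarrow> 0 \<longleftrightarrow> converges_basically F f"
    by blast
  interpret Metric_space \<W> d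
    by fact
  \<comment> \<open>The zero function is the empty sum of spikes.\<close>
  have zero: "(\<lambda>x. 0) \<in> \<W>"
    using spikes_in_W[of undefined 0 0] by (simp add: spikes_def[abs_def])
  have "(1 :: real) \<in> \<rat> \<inter> {0<..}"
    by simp
  then have "range (from_nat_into (\<rat> \<inter> {0<..})) = (\<rat> \<inter> {0<..} :: real set)"
    by (intro range_from_nat_into countable_Int1 countable_rat) blast
  then obtain p :: "nat \<Rightarrow> real" where p: "range p = \<rat> \<inter> {0<..}" ..
  \<comment> \<open>Metrizability is used in both directions: basic convergence of each row yields a
    metrically close member, and metric convergence of the chosen diagonal then forces its basic
    convergence.\<close>
  have "\<exists>n. d (spikes p m n) (\<lambda>x. 0) < 1 / real (Suc m)" for m
  proof -
    have "(\<lambda>n. d (spikes p m n) (\<lambda>x. 0)) \<longlonglongrightarrow> 0"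
      by (subst iff) (auto intro: spikes_in_W zero spikes_converges_basically)
    then have "\<forall>\<^sub>F n in sequentially. d (spikes p m n) (\<lambda>x. 0) < 1 / real (Suc m)"
      by (rule order_tendstoD) simp
    then show ?thesis
      by (auto simp: eventually_sequentially)
  qed
  then obtain N where N: "\<And>m. d (spikes p m (N m)) (\<lambda>x. 0) < 1 / real (Suc m)"
    by metis
  have "(\<lambda>m. d (spikes p m (N m)) (\<lambda>x. 0)) \<longlonglongrightarrow> 0"
  proof (rule tendsto_sandwich[OF _ _ tendsto_const LIMSEQ_inverse_real_of_nat])
    show "\<forall>\<^sub>F m in sequentially. d (spikes p m (N m)) (\<lambda>x. 0) \<le> inverse (real (Suc m))"
      using N by (intro always_eventually allI) (simp only: inverse_eq_divide less_imp_le)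
  qed simp
  then have "converges_basically (\<lambda>m. spikes p m (N m)) (\<lambda>x. 0)"
    by (subst (asm) iff) (auto intro: spikes_in_W zero)
  with spikes_diagonal_not_converges_basically[OF p] show False
    by blast
qed

end
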